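(* For any deterministic online algorithm $A$ with buffer size less than $4M-2$, there exists an input $I$ (with no duplicate elements) such that the output $S$ of $A$ on $I$ satisfies $R(S)\ge\tfrac32\,\mathrm{OPT}$, where $\mathrm{OPT}$ is the optimal number of runs on $I$ given an $M$-size buffer.
   Context: Up-down run generation problem: an input stream $I$ of elements from a totally ordered set is presented in order to an algorithm with a buffer of some fixed number of slots; the algorithm reads elements in order into the buffer and writes elements from the buffer to an output sequence $S$, each write freeing a slot that is filled by the next input element. An online algorithm decides what to write using only the buffer contents, elements already written, and internal state, without knowledge of unread input. A run is a sorted or reverse-sorted sequence; $R(S)$ is the smallest $k$ such that $S$ is a concatenation of $k$ runs; $\mathrm{OPT}$ is the minimum number of runs of any output achievable on $I$ by an (offline) algorithm with buffer size $M$.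
   Formalization: The formal theorem assumes M ≥ 2 and asks for a non-empty I over an infinite ordered set, with A's buffer size at least 1; for M = 1 the only buffer size below 4M-2 is 1, every output equals the input, so R(S) = OPT and the bound fails on every non-empty input. *)

theory Defs
  imports Complex_Main
begin

definition is_run :: "'a::linorder list \<Rightarrow> bool" where
  "is_run r \<longleftrightarrow> sorted r \<or> sorted (rev r)"

definition num_runs :: "'a::linorder list \<Rightarrow> nat" where
  "num_runs S = (LEAST k. \<exists>rs. length rs = k \<and> concat rs = S \<and> (\<forall>r\<in>set rs. is_run r))"

(* Writing x frees a slot, which the next unread element (if there is one) takes at once;
   hence the buffer stays full until the input is exhausted.  Buffers are lists in order of
   arrival. *)
definition write_elem :: "'a \<Rightarrow> 'a list \<times> 'a list \<Rightarrow> 'a list \<times> 'a list" where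
  "write_elem x = (\<lambda>(buf, unread). (remove1 x buf @ take 1 unread, drop 1 unread))"

inductive writes :: "'a list \<times> 'a list \<Rightarrow> 'a list \<Rightarrow> bool" where
  writes_Nil: "writes ([], []) []"
| writes_Cons: "x \<in> set buf \<Longrightarrow> writes (write_elem x (buf, unread)) S \<Longrightarrow> writes (buf, unread) (x # S)"

definition achievable :: "nat \<Rightarrow> 'a list \<Rightarrow> 'a list \<Rightarrow> bool" where
  "achievable M I S \<longleftrightarrow> writes (take M I, drop M I) S"

definition OPT :: "nat \<Rightarrow> 'a::linorder list \<Rightarrow> nat" where
  "OPT M I = (LEAST k. \<exists>S. achievable M I S \<and> num_runs S = k)"

(* A deterministic online algorithm with internal states in 's (an arbitrary, possibly infinite
   type).  From the current state, the sequence written so far and the buffer contents, "decide"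
   yields the element to write next and the new state. *)
record ('s, 'a) online_alg =
  initial :: 's
  decide :: "'s \<Rightarrow> 'a list \<Rightarrow> 'a list \<Rightarrow> 'a \<times> 's"

definition valid_alg :: "('s, 'a) online_alg \<Rightarrow> bool" where
  "valid_alg A \<longleftrightarrow> (\<forall>s S buf. buf \<noteq> [] \<longrightarrow> fst (decide A s S buf) \<in> set buf)"

(* State, output, and (buffer, unread input) after t writes. *)
primrec online_conf ::
  "('s, 'a) online_alg \<Rightarrow> nat \<Rightarrow> 'a list \<Rightarrow> nat \<Rightarrow> 's \<times> 'a list \<times> 'a list \<times> 'a list" where
  "online_conf A B I 0 = (initial A, [], take B I, drop B I)"
| "online_conf A B I (Suc t) =
     (let (s, S, buf, unread) = online_conf A B I t;
          (x, s') = decide A s S buf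
      in (s', S @ [x], write_elem x (buf, unread)))"

definition online_output :: "('s, 'a) online_alg \<Rightarrow> nat \<Rightarrow> 'a list \<Rightarrow> 'a list" where
  "online_output A B I = fst (snd (online_conf A B I (length I)))"

end

theory Submission
  imports Defs
begin

text \<open>
  An algorithm that sees fewer than 4M - 2 elements may be assumed to have buffer size 4m + 1,
  where m = M - 1.  The adversary opens with 4m + 1 elements which an M-buffer can process so far
  both as one descending run (keeping back m high elements \<open>hs\<close>) and as one ascending run (keeping
  back m low elements \<open>ls\<close>).  The algorithm now writes some x.  If x lies in the lower half, the
  next element q is a new minimum, otherwise a new maximum; then the algorithm writes y.

  If x < y after a new minimum, the adversary continues with a long descending sequence, all of it
  unusable for the ascending run of the algorithm.  If y < x, then at most 2m elements are left that
  could extend the descending run, and the adversary presents 2m + 1 elements above y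
  (\<open>mid\<close>) that an M-buffer can sort in either direction; so the algorithm has to leave its run
  before it learns the direction.  The other two cases are symmetric.

  At this point the algorithm has left its first run, with a last written element w, and still
  holds some r.  A final element on the opposite side of w from r, beyond everything else, forces
  a third run.  An M-buffer needs only two runs whichever final element is chosen.
\<close>

section \<open>Decompositions into runs\<close>

lemma num_runs_le_2:
  assumes "is_run r1" and "is_run r2"
  shows "num_runs (r1 @ r2) \<le> 2"
  unfolding num_runs_def
  by (rule Least_le, rule exI[of _ "[r1, r2]"]) (use assms in auto)

lemma num_runs_decomposition:
  "\<exists>rs. length rs = num_runs S \<and> concat rs = S \<and> (\<forall>r\<in>set rs. is_run r)"
  unfolding num_runs_def
proof (rule LeastI_ex)
  have "concat (map (\<lambda>x. [x]) S) = S \<and> (\<forall>r\<in>set (map (\<lambda>x. [x]) S). is_run r)"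
    by (auto simp: is_run_def)
  then show "\<exists>k rs. length rs = k \<and> concat rs = S \<and> (\<forall>r\<in>set rs. is_run r)"
    by blast
qed

lemma is_run_appendD:
  assumes "is_run (xs @ ys)"
  shows "is_run xs" and "is_run ys"
  using assms by (auto simp: is_run_def sorted_append)

text \<open>In a split into two runs, \<open>w\<close> falls into one of them: then either the first
  contains \<open>p @ [w]\<close> or the second contains \<open>w # c\<close>, and contiguous parts
  of runs are runs.\<close>

lemma num_runs_ge_3:
  assumes "\<not> is_run (p @ [w])" and "\<not> is_run (w # c)"
  shows "num_runs (p @ w # c) \<ge> 3"
proof (rule ccontr)
  assume "\<not> ?thesis"
  then obtain rs where rs: "length rs < 3" "concat rs = p @ w # c" "\<forall>r\<in>set rs. is_run r"
    using num_runs_decomposition[of "p @ w # c"] by (metis not_le)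
  \<comment> \<open>Decompositions into fewer than two parts are padded with the empty run.\<close>
  obtain r1 r2 where r: "r1 @ r2 = p @ w # c" "is_run r1" "is_run r2"
  proof -
    have "is_run []" by (simp add: is_run_def)
    moreover have "rs = [] \<or> (\<exists>a. rs = [a]) \<or> (\<exists>a b. rs = [a, b])"
      using rs(1) by (cases rs; cases "tl rs") auto
    ultimately show ?thesis using rs(2,3) that[of "concat rs" "[]"] that by auto
  qed
  from r(1) have "(\<exists>us. p = r1 @ us \<and> r2 = us @ w # c) \<or> (\<exists>us. r1 = p @ w # us)"
    unfolding append_eq_append_conv2 by (metis append_Nil2 append_eq_Cons_conv append_Nil)
  then show False
  proof (elim disjE exE conjE)
    fix us assume "r2 = us @ w # c"
    then show False using r(3) assms(2) is_run_appendD(2)[of us "w # c"] by simp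
  next
    fix us assume "r1 = p @ w # us"
    then show False using r(2) assms(1) is_run_appendD(1)[of "p @ [w]" us] by simp
  qed
qed

lemma is_run_map:
  assumes "is_run xs" and "mono_on (set xs) f"
  shows "is_run (map f xs)"
proof -
  have "sorted (map f ys)" if "sorted ys" "set ys = set xs" for ys
    unfolding sorted_map
    by (rule sorted_wrt_mono_rel[OF _ that(1)]) (use assms(2) that(2) in \<open>auto dest: mono_onD\<close>)
  from this[of xs] this[of "rev xs"] assms(1) show ?thesis
    by (auto simp: is_run_def rev_map)
qed

section \<open>Online algorithms acting on a queue\<close>

text \<open>
  Buffers are kept in order of arrival, so buffer and unread input together form one queue of which
  the algorithm sees the first B entries; hence a larger buffer only enlarges the view of the queue.
\<close>

primrec queue_conf :: "('s, 'a) online_alg \<Rightarrow> nat \<Rightarrow> 'a list \<Rightarrow> nat \<Rightarrow> 's \<times> 'a list \<times> 'a list" where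
  "queue_conf A B I 0 = (initial A, [], I)"
| "queue_conf A B I (Suc t) =
     (let (s, S, Z) = queue_conf A B I t; (x, s') = decide A s S (take B Z)
      in (s', S @ [x], remove1 x Z))"

definition outp :: "('s, 'a) online_alg \<Rightarrow> nat \<Rightarrow> 'a list \<Rightarrow> nat \<Rightarrow> 'a list" where
  "outp A B I t = fst (snd (queue_conf A B I t))"

lemma queue_conf_inv:
  assumes "valid_alg A" "1 \<le> B" "distinct I" "t \<le> length I"
    and "queue_conf A B I t = (s, S, Z)"
  shows "length S = t \<and> distinct (S @ Z) \<and> set (S @ Z) = set I"
  using assms(4,5)
proof (induction t arbitrary: s S Z)
  case 0
  then show ?case using assms(3) by auto
next
  case (Suc t)
  obtain s0 S0 Z0 where c: "queue_conf A B I t = (s0, S0, Z0)" by (metis prod_cases3)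
  have IH: "length S0 = t" "distinct (S0 @ Z0)" "set (S0 @ Z0) = set I"
    using Suc.IH[OF _ c] Suc.prems by auto
  have "length (S0 @ Z0) = length I"
    using IH assms(3) by (metis distinct_card)
  then have "Z0 \<noteq> []" using IH(1) Suc.prems(1) by auto
  then have "take B Z0 \<noteq> []" using assms(2) by auto
  then have x: "fst (decide A s0 S0 (take B Z0)) \<in> set Z0"
    using assms(1) by (meson valid_alg_def in_set_takeD)
  have "S = S0 @ [fst (decide A s0 S0 (take B Z0))]"
    "Z = remove1 (fst (decide A s0 S0 (take B Z0))) Z0"
    using Suc.prems(2) c by (auto simp: Let_def split: prod.splits)
  then show ?case using IH x by (auto simp: distinct_remove1)
qed

lemma queue_conf_decide_mem:
  assumes "valid_alg A" "1 \<le> B" "distinct I" "t < length I"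
    and "queue_conf A B I t = (s, S, Z)"
  shows "fst (decide A s S (take B Z)) \<in> set (take B Z)" and "length Z = length I - t"
proof -
  have *: "length S = t" "distinct (S @ Z)" "set (S @ Z) = set I"
    using queue_conf_inv[OF assms(1-3) _ assms(5)] assms(4) by auto
  then have "length (S @ Z) = length I"
    using assms(3) by (metis distinct_card)
  then show "length Z = length I - t" using * by auto
  then have "take B Z \<noteq> []" using assms(2,4) by auto
  then show "fst (decide A s S (take B Z)) \<in> set (take B Z)"
    using assms(1) by (meson valid_alg_def)
qed

lemma write_elem_take_drop:
  assumes "x \<in> set (take B Z)"
  shows "write_elem x (take B Z, drop B Z) = (take B (remove1 x Z), drop B (remove1 x Z))"
proof -
  obtain B' where B: "B = Suc B'" using assms by (cases B) auto
  have "remove1 x Z = remove1 x (take B Z) @ drop B Z"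
    using assms by (metis append_take_drop_id remove1_append)
  \<comment> \<open>If the view is not full, nothing lies beyond it; otherwise exactly one slot
    becomes free and the next entry of the queue moves in.\<close>
  moreover have "length (remove1 x (take B Z)) = B' \<or> drop B Z = []"
    using assms B by (auto simp: length_remove1)
  ultimately show ?thesis
    using assms B by (auto simp: write_elem_def length_remove1)
qed

lemma online_conf_eq:
  assumes "valid_alg A" "1 \<le> B" "distinct I" "t \<le> length I"
    and "queue_conf A B I t = (s, S, Z)"
  shows "online_conf A B I t = (s, S, take B Z, drop B Z)"
  using assms(4,5)
proof (induction t arbitrary: s S Z)
  case (Suc t)
  obtain s0 S0 Z0 where c: "queue_conf A B I t = (s0, S0, Z0)" by (metis prod_cases3)
  have "fst (decide A s0 S0 (take B Z0)) \<in> set (take B Z0)"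
    using queue_conf_decide_mem[OF assms(1-3) _ c] Suc.prems by simp
  then show ?case using Suc.IH[OF _ c] Suc.prems c
    by (auto simp: Let_def write_elem_take_drop split: prod.splits)
qed auto

lemma online_output_eq:
  assumes "valid_alg A" "1 \<le> B" "distinct I"
  shows "online_output A B I = outp A B I (length I)"
  using online_conf_eq[OF assms order_refl]
  by (cases "queue_conf A B I (length I)") (auto simp: online_output_def outp_def)

text \<open>Makes an algorithm for a \<open>B\<close>-buffer run with a larger buffer and the same
  output, so that the adversary need only treat one buffer size.\<close>

definition with_view :: "nat \<Rightarrow> ('s, 'a) online_alg \<Rightarrow> ('s, 'a) online_alg" where
  "with_view B A = \<lparr>initial = initial A, decide = (\<lambda>s S buf. decide A s S (take B buf))\<rparr>"

lemma valid_alg_with_view: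
  assumes "valid_alg A" "1 \<le> B"
  shows "valid_alg (with_view B A)"
  unfolding valid_alg_def
proof (intro allI impI)
  fix s S and buf :: "'b list"
  assume "buf \<noteq> []"
  then have "take B buf \<noteq> []" using assms(2) by auto
  then have "fst (decide A s S (take B buf)) \<in> set (take B buf)"
    using assms(1) by (simp add: valid_alg_def)
  then show "fst (decide (with_view B A) s S buf) \<in> set buf"
    by (auto simp: with_view_def dest: in_set_takeD)
qed

lemma online_output_with_view:
  assumes "valid_alg A" "1 \<le> B" "B \<le> B'" "distinct I"
  shows "online_output (with_view B A) B' I = online_output A B I"
proof -
  have "queue_conf (with_view B A) B' I t = queue_conf A B I t" for t
    using assms(3) by (induction t) (auto simp: with_view_def Let_def min_def split: prod.splits)
  then show ?thesis
    using assms by (simp add: online_output_eq valid_alg_with_view outp_def)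
qed

text \<open>Before the last of the \<open>t\<close> writes, at least \<open>B\<close> entries of
  \<open>I\<close> are still in the queue, so no decision so far has seen \<open>K\<close>. This
  lets the adversary choose \<open>K\<close> in reply to the output.\<close>

lemma queue_conf_append:
  assumes "valid_alg A" "1 \<le> B" "distinct I" "B + t \<le> Suc (length I)"
    and "queue_conf A B I t = (s, S, Z)"
  shows "queue_conf A B (I @ K) t = (s, S, Z @ K)"
  using assms(4,5)
proof (induction t arbitrary: s S Z)
  case (Suc t)
  obtain s0 S0 Z0 where c: "queue_conf A B I t = (s0, S0, Z0)" by (metis prod_cases3)
  have t: "t < length I" using Suc.prems assms(2) by auto
  have *: "fst (decide A s0 S0 (take B Z0)) \<in> set (take B Z0)" "length Z0 = length I - t"
    using queue_conf_decide_mem[OF assms(1-3) t c] by auto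
  then have "fst (decide A s0 S0 (take B Z0)) \<in> set Z0" by (blast dest: in_set_takeD)
  moreover have "take B (Z0 @ K) = take B Z0" using * Suc.prems by simp
  ultimately show ?case using Suc.IH[OF _ c] Suc.prems c
    by (auto simp: Let_def remove1_append split: prod.splits)
qed auto

lemma outp_append:
  assumes "valid_alg A" "1 \<le> B" "distinct I" "B + t \<le> Suc (length I)"
  shows "outp A B (I @ K) t = outp A B I t"
  using queue_conf_append[OF assms] by (cases "queue_conf A B I t") (auto simp: outp_def)

lemma outp_take:
  assumes "t \<le> t'"
  shows "\<exists>C. outp A B I t' = outp A B I t @ C"
  using assms
proof (induction t' rule: dec_induct)
  case (step n)
  then show ?case by (auto simp: outp_def Let_def split: prod.splits)
qed auto

lemma outp_props:
  assumes "valid_alg A" "1 \<le> B" "distinct I" "t \<le> length I"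
  shows "length (outp A B I t) = t" "distinct (outp A B I t)" "set (outp A B I t) \<subseteq> set I"
  using queue_conf_inv[OF assms] by (cases "queue_conf A B I t"; auto simp: outp_def)+

section \<open>Forcing a third run\<close>

text \<open>The first \<open>length J - B + 1\<close> writes are decided without sight of
  \<open>f\<close>, so \<open>f\<close> may depend on the last of them, \<open>w\<close>. Both
  \<open>f\<close> and an unwritten \<open>r\<close> are still to come, on opposite sides of
  \<open>w\<close>, so no run can start at \<open>w\<close> and contain both.\<close>

lemma not_run_forces_three:
  fixes A :: "('s, 'a::linorder) online_alg"
  assumes "valid_alg A" "2 \<le> B" "distinct J" "B \<le> length J"
    and nrun: "\<not> is_run (outp A B J (Suc (length J - B)))"
    and bounds: "\<forall>v\<in>set J. lo < v \<and> v < hi" "lo < hi"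
  shows "\<exists>f\<in>{lo, hi}. num_runs (online_output A B (J @ [f])) \<ge> 3"
proof -
  let ?T = "length J - B"
  define D where "D = outp A B J (Suc ?T)"
  have B1: "1 \<le> B" using assms(2) by simp
  have D: "length D = Suc ?T" "distinct D" "set D \<subseteq> set J"
    using outp_props[OF assms(1) B1 assms(3), of "Suc ?T"] assms(2,4) by (auto simp: D_def)
  then obtain p w where pw: "D = p @ [w]" by (cases D rule: rev_cases) auto
  \<comment> \<open>\<open>D\<close> misses an element of \<open>J\<close> because \<open>B\<close>
    is at least 2.\<close>
  have "card (set D) < card (set J)"
    using D assms(2-4) by (simp add: distinct_card)
  then obtain r where r: "r \<in> set J" "r \<notin> set D"
    by (metis card_mono[OF finite_set] subsetI leD)
  \<comment> \<open>This puts \<open>w\<close> strictly between \<open>r\<close> and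
    \<open>f\<close>.\<close>
  define f where "f = (if r < w then hi else lo)"
  have w: "w \<in> set J" using D(3) pw by auto
  have f: "f \<notin> set J" using bounds by (auto simp: f_def)
  have dist: "distinct (J @ [f])" using assms(3) f by auto
  obtain C where C: "outp A B (J @ [f]) (length (J @ [f])) = D @ C"
  proof -
    have "Suc ?T \<le> length (J @ [f])" by simp
    from outp_take[OF this, of A B "J @ [f]"] show ?thesis
      using that outp_append[OF assms(1) B1 assms(3), of "Suc ?T" "[f]"] assms(4)
      by (auto simp: D_def)
  qed
  have "set (outp A B (J @ [f]) (length (J @ [f]))) = set (J @ [f])"
    using outp_props[OF assms(1) B1 dist order_refl] distinct_card[OF dist]
    by (intro card_subset_eq) (simp_all only: distinct_card finite_set)
  then have "r \<in> set C" "f \<in> set C" using r f D(3) C by auto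
  moreover have "r \<noteq> w" using r pw by auto
  ultimately have "\<not> is_run (w # C)"
    using bounds w by (cases "r < w") (fastforce simp: is_run_def sorted_append f_def)+
  then have "num_runs (p @ w # C) \<ge> 3"
    using nrun by (intro num_runs_ge_3) (simp_all add: D_def[symmetric] pw)
  then have "num_runs (online_output A B (J @ [f])) \<ge> 3"
    using online_output_eq[OF assms(1) B1 dist] C pw by simp
  then show ?thesis by (auto simp: f_def split: if_splits)
qed

section \<open>Offline schedules\<close>

text \<open>
  R collects everything read, already written or not; one element is read before each write.  So R
  initially stands for M - 1 elements.
\<close>

primrec avail :: "'a set \<Rightarrow> 'a list \<Rightarrow> 'a list \<Rightarrow> bool" where
  "avail R u [] = True"
| "avail R u (x # X) = (x \<in> R \<union> set (take 1 u) \<and> avail (R \<union> set (take 1 u)) (drop 1 u) X)"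

lemma avail_subset: "set X \<subseteq> R \<Longrightarrow> avail R u X"
  by (induction X arbitrary: R u) (auto simp: le_supI1)

lemma avail_mono: "avail R u X \<Longrightarrow> R \<subseteq> R' \<Longrightarrow> avail R' u X"
proof (induction X arbitrary: R R' u)
  case (Cons x X)
  then have "R \<union> set (take 1 u) \<subseteq> R' \<union> set (take 1 u)" by auto
  with Cons show ?case by (auto simp del: take_Suc)
qed simp

text \<open>The buffer serves as a delay line: each arriving element joins the back of the list
  \<open>X\<close> of pending elements while the front one is written, so all pending elements have
  been read.\<close>

lemma avail_delay: "set X \<subseteq> R \<Longrightarrow> avail R u (X @ u)"
proof (induction u arbitrary: X R)
  case Nil
  then show ?case by (auto intro: avail_subset)
next
  case (Cons a v)
  show ?case
  proof (cases X)
    case Nil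
    then show ?thesis using Cons.IH[of "[]" "insert a R"] by simp
  next
    case (Cons x X')
    then show ?thesis using Cons.IH[of "X' @ [a]" "insert a R"] Cons.prems by auto
  qed
qed

text \<open>While \<open>V\<close> arrives, either equally many old elements are written or every
  element of \<open>V\<close> is passed on at once. The schedules below are assembled from such
  blocks.\<close>

lemma avail_block:
  assumes "length X = length V" "set X \<subseteq> R \<or> X = V" "avail (R \<union> set V) u Y"
  shows "avail R (V @ u) (X @ Y)"
  using assms
proof (induction X V arbitrary: R rule: list_induct2)
  case (Cons x X v V)
  have "set X \<subseteq> insert v R \<or> X = V" using Cons.prems(1) by auto
  then have "avail (insert v R) (V @ u) (X @ Y)"
    using Cons.IH Cons.prems(2) by simp
  then show ?case using Cons.prems(1) by auto
qed simp

text \<open>\<open>avail\<close> never forgets an element, so \<open>W\<close> keeps apart those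
  already written. Since they do not recur in \<open>S\<close>, an available next element must be in
  the buffer.\<close>

lemma writes_if_avail:
  assumes "distinct (buf @ u)" "distinct S" "set S = set (buf @ u)" "W \<inter> set S = {}"
    and "avail (set buf \<union> W) u S"
  shows "writes (buf @ take 1 u, drop 1 u) S"
  using assms
proof (induction S arbitrary: buf u W)
  case Nil
  then show ?case by (auto intro: writes_Nil)
next
  case (Cons x S)
  define c v where "c = buf @ take 1 u" and "v = drop 1 u"
  have cv: "c @ v = buf @ u" by (simp add: c_def v_def)
  then have set_cv: "set c \<union> set v = insert x (set S)"
    using Cons.prems(3) by (metis set_append list.simps(15))
  have d: "distinct c" "distinct v" "set c \<inter> set v = {}"
    using Cons.prems(1) cv by (metis distinct_append)+
  have S: "x \<notin> set S" "distinct S" using Cons.prems(2) by simp_all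
  have av: "x \<in> set c \<union> W" "avail (set c \<union> W) v S"
    using Cons.prems(5) by (simp_all add: c_def v_def Un_ac)
  then have x: "x \<in> set c" using Cons.prems(4) by auto
  have rc: "set (remove1 x c) = set c - {x}" using d(1) by (rule set_remove1_eq)
  have "writes (remove1 x c @ take 1 v, drop 1 v) S"
  proof (rule Cons.IH[where W = "insert x W"])
    show "distinct (remove1 x c @ v)"
      unfolding distinct_append rc using d by (auto intro: distinct_remove1)
    show "distinct S" by (fact S)
    show "set S = set (remove1 x c @ v)"
      unfolding set_append rc using set_cv x S(1) d(3) by blast
    show "insert x W \<inter> set S = {}" using Cons.prems(4) S(1) by auto
    show "avail (set (remove1 x c) \<union> insert x W) v S"
      unfolding rc by (rule avail_mono[OF av(2)]) blast
  qed
  then show ?case using x by (intro writes_Cons) (simp_all add: write_elem_def c_def v_def)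
qed

lemma achievable_if_avail:
  assumes "distinct I" "distinct S" "set S = set I" "avail (set (take m I)) (drop m I) S"
  shows "achievable (Suc m) I S"
proof -
  have "writes (take m I @ take 1 (drop m I), drop 1 (drop m I)) S"
    using assms by (intro writes_if_avail[where W = "{}"]) auto
  moreover have "take m I @ take 1 (drop m I) = take (Suc m) I"
    using take_add[of m 1 I] by simp
  ultimately show ?thesis by (simp add: achievable_def)
qed

lemma avail_image: "avail R u X \<Longrightarrow> avail (e ` R) (map e u) (map e X)"
proof (induction X arbitrary: R u)
  case (Cons x X)
  have "set (take 1 (map e u)) = e ` set (take 1 u)" by (cases u) auto
  then have "e ` R \<union> set (take 1 (map e u)) = e ` (R \<union> set (take 1 u))" by auto
  with Cons show ?case by (simp only: avail.simps list.map drop_map) blast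
qed simp

text \<open>Schedules and runs are built over the integers; \<open>e\<close> carries both to the
  ordered type of the algorithm.\<close>

lemma OPT_le_2:
  fixes e :: "'b::linorder \<Rightarrow> 'a::linorder"
  assumes "distinct I" "set (r1 @ r2) = set I" "length (r1 @ r2) = length I"
    and "avail (set (take m I)) (drop m I) (r1 @ r2)" "is_run r1" "is_run r2"
    and e: "strict_mono_on K e" "set I \<subseteq> K"
  shows "OPT (Suc m) (map e I) \<le> 2"
proof -
  have inj: "inj_on e (set I)"
    using e by (meson strict_mono_on_imp_inj_on inj_on_subset)
  have "distinct (r1 @ r2)"
    using assms(1-3) by (metis card_distinct distinct_card)
  then have "achievable (Suc m) (map e I) (map e r1 @ map e r2)"
    using avail_image[OF assms(4), of e] assms(1,2) inj
    by (intro achievable_if_avail)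
       (simp_all add: distinct_map take_map drop_map flip: map_append image_Un set_append)
  moreover have "mono_on (set r) e" if "set r \<subseteq> set I" for r
    using strict_mono_on_imp_mono_on[OF e(1)] e(2) that by (meson mono_on_subset subset_trans)
  then have "num_runs (map e r1 @ map e r2) \<le> 2"
    using assms(2,5,6) by (intro num_runs_le_2 is_run_map) auto
  moreover have "OPT (Suc m) (map e I) \<le> num_runs (map e r1 @ map e r2)"
    unfolding OPT_def using calculation(1) by (intro Least_le) blast
  ultimately show ?thesis by linarith
qed

text \<open>\<open>hi\<close> and \<open>L\<close> are passed on at once; in between,
  \<open>rev lo\<close> goes out while \<open>H\<close> comes in. \<open>H\<close> is kept for
  later.\<close>

lemma avail_down:
  assumes "length lo = length H" "avail (set (lo @ hi @ H @ L)) u X"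
  shows "avail (set lo) (hi @ H @ L @ u) (hi @ rev lo @ L @ X)"
  using assms by (intro avail_block) (auto simp: Un_assoc)

text \<open>\<open>lo\<close> goes out while \<open>hi\<close> comes in, \<open>rev hi\<close> while
  \<open>H\<close> does, and \<open>H\<close> while \<open>L\<close> does. \<open>L\<close> is kept
  for later.\<close>

lemma avail_up:
  assumes "length lo = length hi" "length hi = length H" "length H = length L"
    and "avail (set (lo @ hi @ [c] @ H @ L)) u X"
  shows "avail (set lo) (hi @ [c] @ H @ L @ u) (lo @ [c] @ rev hi @ H @ X)"
  using assms by (intro avail_block) (auto simp: Un_assoc)

text \<open>The elements \<open>W\<close> kept back from before are written while \<open>lo\<close>
  arrives; then \<open>hi\<close> is passed on at once and \<open>lo\<close> is reversed at the
  end.\<close>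

lemma avail_mid_down:
  assumes "set W \<subseteq> R" "length W = length lo"
  shows "avail R ([q] @ lo @ hi @ [b]) ([q] @ W @ hi @ rev lo @ [b])"
  using assms by (intro avail_block avail_delay) auto

text \<open>Two delays in succession: \<open>W\<close> is written during \<open>lo\<close> and
  \<open>lo\<close> during \<open>hi\<close>, which leaves \<open>hi\<close> to be reversed after
  \<open>c\<close>.\<close>

lemma avail_mid_up:
  assumes "set W \<subseteq> R" "length W = length lo" "length lo = length hi"
  shows "avail R ([q] @ lo @ hi @ [c] @ [b]) ([q] @ W @ lo @ [c] @ rev hi @ [b])"
  using assms by (intro avail_block avail_delay) auto

section \<open>Adversarial inputs and their two-run outputs\<close>

text \<open>
  The first 2m + 1 elements of \<open>base\<close>, like those of \<open>mid\<close>, arrive as the lowest m in ascending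
  order, then all others in descending order: either part can be held back in the buffer while the
  other one is written in the direction of its arrival.  The numbers are spaced such that \<open>mid\<close>
  falls just below the median 2m + 2 of \<open>base\<close>.
\<close>

definition c_low :: "nat \<Rightarrow> int list" where "c_low m = [- int m..-1]"
definition c_high :: "nat \<Rightarrow> int list" where "c_high m = rev [2 * int m + 3..3 * int m + 2]"
definition hs :: "nat \<Rightarrow> int list" where "hs m = [3 * int m + 3..4 * int m + 2]"
definition ls :: "nat \<Rightarrow> int list" where "ls m = rev [- 2 * int m..- int m - 1]"
definition e_low :: "nat \<Rightarrow> int list" where "e_low m = [1..int m]"
definition e_high :: "nat \<Rightarrow> int list" where "e_high m = rev [int m + 2..2 * int m + 1]"
definition base :: "nat \<Rightarrow> int list" where
  "base m = c_low m @ c_high m @ [2 * int m + 2] @ hs m @ ls m"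
definition mid :: "nat \<Rightarrow> int list" where
  "mid m = e_low m @ e_high m @ [int m + 1]"
text \<open>\<open>q_low\<close> and \<open>q_high\<close> start with the two possible values of
  \<open>q\<close>, and each has one element more than \<open>base\<close>, which the counting
  argument needs. \<open>below\<close> and \<open>above\<close>, just beyond all other elements, are
  the candidates for the final one.\<close>

definition q_low :: "nat \<Rightarrow> int list" where "q_low m = rev [- 6 * int m - 2..- 2 * int m - 1]"
definition q_high :: "nat \<Rightarrow> int list" where "q_high m = [4 * int m + 3..8 * int m + 4]"
definition below :: "nat \<Rightarrow> int" where "below m = - 6 * int m - 3"
definition above :: "nat \<Rightarrow> int" where "above m = 8 * int m + 5"

lemmas list_defs = c_low_def c_high_def hs_def ls_def e_low_def e_high_def base_def mid_def
  q_low_def q_high_def below_def above_def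

lemma set_base: "set (base m) = {- 2 * int m..-1} \<union> {2 * int m + 2..4 * int m + 2}"
  and set_mid: "set (mid m) = {1..2 * int m + 1}"
  and length_base: "length (base m) = 4 * m + 1"
  and length_mid: "length (mid m) = 2 * m + 1"
  and distinct_base: "distinct (base m)"
  and distinct_mid: "distinct (mid m)"
  and length_q_low: "length (q_low m) = 4 * m + 2"
  and length_q_high: "length (q_high m) = 4 * m + 2"
  by (auto simp: list_defs)

text \<open>The first m elements of the input are \<open>c_low m\<close>. Of \<open>base m\<close>,
  only \<open>hs m\<close> is missing from the descending run, so it remains for
  \<open>X\<close>.\<close>

lemma avail_base_down:
  assumes "avail (set (base m)) u X"
  shows "avail (set (take m (base m @ u))) (drop m (base m @ u))
    ((c_high m @ [2 * int m + 2]) @ rev (c_low m) @ ls m @ X)"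
  using avail_down[of "c_low m" "hs m" "c_high m @ [2 * int m + 2]" "ls m" u X] assms
  by (simp add: base_def list_defs)

text \<open>Here \<open>ls m\<close> is the part kept back.\<close>

lemma avail_base_up:
  assumes "avail (set (base m)) u X"
  shows "avail (set (take m (base m @ u))) (drop m (base m @ u))
    (c_low m @ [2 * int m + 2] @ rev (c_high m) @ hs m @ X)"
  using avail_up[of "c_low m" "c_high m" "hs m" "ls m" "2 * int m + 2" u X] assms
  by (simp add: base_def list_defs)


text \<open>\<open>f\<close> fixes the direction of both runs: descending for
  \<open>below m\<close>, ascending for \<open>above m\<close>. In either direction
  \<open>q\<close>, being beyond \<open>base m\<close> on one side, can end the first run or start
  the second.\<close>

lemma OPT_mid:
  fixes e :: "int \<Rightarrow> 'a::linorder"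
  assumes e: "strict_mono_on {below m..above m} e"
    and q: "q \<in> {- 2 * int m - 1, 4 * int m + 3}" and f: "f \<in> {below m, above m}"
  shows "OPT (Suc m) (map e (base m @ [q] @ mid m @ [f])) \<le> 2"
proof -
  define t where "t = [q] @ mid m @ [f]"
  have I: "distinct (base m @ t)" "set (base m @ t) \<subseteq> {below m..above m}"
    using q f by (auto simp: t_def list_defs)
  have "OPT (Suc m) (map e (base m @ t)) \<le> 2"
  proof (cases "f = below m")
    case True
    define D where "D = (c_high m @ [2 * int m + 2]) @ rev (c_low m) @ ls m"
    \<comment> \<open>The m elements of \<open>hs m\<close> lie above \<open>mid m\<close> and fill
      the time in which \<open>e_low m\<close> arrives, so that \<open>mid m\<close> can follow them
      in descending order.\<close>
    define W where "W = rev (hs m) @ (e_high m @ [int m + 1]) @ rev (e_low m) @ [f]"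
    have "set (rev (hs m)) \<subseteq> set (base m)" "length (rev (hs m)) = length (e_low m)"
      by (auto simp: base_def hs_def e_low_def)
    from avail_mid_down[OF this, of q "e_high m @ [int m + 1]" f]
    have "avail (set (base m)) t ([q] @ W)"
      by (simp add: t_def W_def mid_def)
    from avail_base_down[OF this]
    have a: "avail (set (take m (base m @ t))) (drop m (base m @ t)) (D @ [q] @ W)"
      by (simp add: D_def)
    have s: "set (D @ [q] @ W) = set (base m @ t)" "length (D @ [q] @ W) = length (base m @ t)"
      by (auto simp: D_def W_def t_def list_defs)
    show ?thesis
    proof (cases "q = - 2 * int m - 1")
      case q: True
      have "is_run (D @ [q])" "is_run W"
        unfolding is_run_def D_def W_def True q
        by (auto simp: list_defs sorted_append)
      then show ?thesis
        using OPT_le_2[OF I(1), of "D @ [q]" W] s a e I(2) by simp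
    next
      case False
      then have q: "q = 4 * int m + 3" using q by auto
      have "is_run D" "is_run ([q] @ W)"
        unfolding is_run_def D_def W_def True q
        by (auto simp: list_defs sorted_append)
      then show ?thesis
        using OPT_le_2[OF I(1), of D "[q] @ W"] s a e I(2) by simp
    qed
  next
    case False
    then have f: "f = above m" using f by simp
    define D where "D = c_low m @ [2 * int m + 2] @ rev (c_high m) @ hs m"
    define W where "W = rev (ls m) @ e_low m @ [int m + 1] @ rev (e_high m) @ [f]"
    have "set (rev (ls m)) \<subseteq> set (base m)" "length (rev (ls m)) = length (e_low m)"
      "length (e_low m) = length (e_high m)"
      by (auto simp: base_def ls_def e_low_def e_high_def)
    from avail_mid_up[OF this, of q "int m + 1" f]
    have "avail (set (base m)) t ([q] @ W)"
      by (simp add: t_def W_def mid_def)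
    from avail_base_up[OF this]
    have a: "avail (set (take m (base m @ t))) (drop m (base m @ t)) (D @ [q] @ W)"
      by (simp add: D_def)
    have s: "set (D @ [q] @ W) = set (base m @ t)" "length (D @ [q] @ W) = length (base m @ t)"
      by (auto simp: D_def W_def t_def list_defs)
    show ?thesis
    proof (cases "q = - 2 * int m - 1")
      case q: True
      have "is_run D" "is_run ([q] @ W)"
        unfolding is_run_def D_def W_def f q
        by (auto simp: list_defs sorted_append)
      then show ?thesis
        using OPT_le_2[OF I(1), of D "[q] @ W"] s a e I(2) by simp
    next
      case False
      then have q: "q = 4 * int m + 3" using q by auto
      have "is_run (D @ [q])" "is_run W"
        unfolding is_run_def D_def W_def f q
        by (auto simp: list_defs sorted_append)
      then show ?thesis
        using OPT_le_2[OF I(1), of "D @ [q]" W] s a e I(2) by simp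
    qed
  qed
  then show ?thesis by (simp add: t_def)
qed

text \<open>\<open>q_low\<close> prolongs the descending run of \<open>base\<close>, so only
  \<open>hs\<close> is left over. \<open>below m\<close> still joins the first run;
  \<open>above m\<close> goes after \<open>hs\<close>, which is ascending.\<close>

lemma OPT_low:
  fixes e :: "int \<Rightarrow> 'a::linorder"
  assumes e: "strict_mono_on {below m..above m} e" and f: "f \<in> {below m, above m}"
  shows "OPT (Suc m) (map e (base m @ q_low m @ [f])) \<le> 2"
proof -
  define t where "t = q_low m @ [f]"
  define D where "D = (c_high m @ [2 * int m + 2]) @ rev (c_low m) @ ls m"
  have I: "distinct (base m @ t)" "set (base m @ t) \<subseteq> {below m..above m}"
    using f by (auto simp: t_def list_defs)
  have "OPT (Suc m) (map e (base m @ t)) \<le> 2"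
  proof (cases "f = below m")
    case True
    have "avail (set (base m)) (t @ []) (t @ hs m)"
      by (intro avail_block avail_subset) (auto simp: base_def)
    from avail_base_down[OF this]
    have a: "avail (set (take m (base m @ t))) (drop m (base m @ t)) ((D @ t) @ hs m)"
      by (simp add: D_def)
    have "is_run (D @ t)" "is_run (hs m)"
      unfolding is_run_def D_def t_def True by (auto simp: list_defs sorted_append)
    then show ?thesis
      by (intro OPT_le_2[OF I(1) _ _ a _ _ e I(2)]) (auto simp: D_def t_def list_defs)
  next
    case False
    then have f: "f = above m" using f by simp
    have "avail (set (base m)) t (q_low m @ hs m @ [f])"
      unfolding t_def by (intro avail_block avail_delay) (auto simp: base_def)
    from avail_base_down[OF this]
    have a: "avail (set (take m (base m @ t))) (drop m (base m @ t)) ((D @ q_low m) @ hs m @ [f])"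
      by (simp add: D_def)
    have "is_run (D @ q_low m)" "is_run (hs m @ [f])"
      unfolding is_run_def D_def f by (auto simp: list_defs sorted_append)
    then show ?thesis
      by (intro OPT_le_2[OF I(1) _ _ a _ _ e I(2)]) (auto simp: D_def t_def list_defs)
  qed
  then show ?thesis by (simp add: t_def)
qed

text \<open>Mirror image of \<open>OPT_low\<close>: the ascending run is prolonged, and the
  descending \<open>ls\<close> is left over.\<close>

lemma OPT_high:
  fixes e :: "int \<Rightarrow> 'a::linorder"
  assumes e: "strict_mono_on {below m..above m} e" and f: "f \<in> {below m, above m}"
  shows "OPT (Suc m) (map e (base m @ q_high m @ [f])) \<le> 2"
proof -
  define t where "t = q_high m @ [f]"
  define D where "D = c_low m @ [2 * int m + 2] @ rev (c_high m) @ hs m"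
  have I: "distinct (base m @ t)" "set (base m @ t) \<subseteq> {below m..above m}"
    using f by (auto simp: t_def list_defs)
  have "OPT (Suc m) (map e (base m @ t)) \<le> 2"
  proof (cases "f = above m")
    case True
    have "avail (set (base m)) (t @ []) (t @ ls m)"
      by (intro avail_block avail_subset) (auto simp: base_def)
    from avail_base_up[OF this]
    have a: "avail (set (take m (base m @ t))) (drop m (base m @ t)) ((D @ t) @ ls m)"
      by (simp add: D_def)
    have "is_run (D @ t)" "is_run (ls m)"
      unfolding is_run_def D_def t_def True by (auto simp: list_defs sorted_append)
    then show ?thesis
      by (intro OPT_le_2[OF I(1) _ _ a _ _ e I(2)]) (auto simp: D_def t_def list_defs)
  next
    case False
    then have f: "f = below m" using f by simp
    have "avail (set (base m)) t (q_high m @ ls m @ [f])"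
      unfolding t_def by (intro avail_block avail_delay) (auto simp: base_def)
    from avail_base_up[OF this]
    have a: "avail (set (take m (base m @ t))) (drop m (base m @ t)) ((D @ q_high m) @ ls m @ [f])"
      by (simp add: D_def)
    have "is_run (D @ q_high m)" "is_run (ls m @ [f])"
      unfolding is_run_def D_def f by (auto simp: list_defs sorted_append)
    then show ?thesis
      by (intro OPT_le_2[OF I(1) _ _ a _ _ e I(2)]) (auto simp: D_def t_def list_defs)
  qed
  then show ?thesis by (simp add: t_def)
qed

section \<open>Counting argument and play of the adversary\<close>

text \<open>The pair \<open>x < y\<close> fixes the direction, so all elements from \<open>y\<close>
  on would have to fit into \<open>{v \<in> V. y \<le> v}\<close>, which is too small.\<close>

lemma not_is_run_up:
  assumes "distinct D" "D = x # y # D'" "x < y" "set D \<subseteq> V" "finite V"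
    and "card {v \<in> V. y \<le> v} < length D - 1"
  shows "\<not> is_run D"
proof
  assume "is_run D"
  then have "set (y # D') \<subseteq> {v \<in> V. y \<le> v}"
    using assms(2-4) by (auto simp: is_run_def sorted_append)
  then have "card (set (y # D')) \<le> card {v \<in> V. y \<le> v}"
    using assms(5) by (intro card_mono) auto
  moreover have "card (set (y # D')) = length D - 1"
    using assms(1,2) distinct_card[of "y # D'"] by simp
  ultimately show False using assms(6) by linarith
qed

lemma not_is_run_down:
  assumes "distinct D" "D = x # y # D'" "y < x" "set D \<subseteq> V" "finite V"
    and "card {v \<in> V. v \<le> y} < length D - 1"
  shows "\<not> is_run D"
proof
  assume "is_run D"
  then have "set (y # D') \<subseteq> {v \<in> V. v \<le> y}"
    using assms(2-4) by (auto simp: is_run_def sorted_append)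
  then have "card (set (y # D')) \<le> card {v \<in> V. v \<le> y}"
    using assms(5) by (intro card_mono) auto
  moreover have "card (set (y # D')) = length D - 1"
    using assms(1,2) distinct_card[of "y # D'"] by simp
  ultimately show False using assms(6) by linarith
qed

text \<open>Any finite subset with as many elements as the interval, listed in increasing order,
  serves as its image.\<close>

lemma ex_strict_mono_on_int_interval:
  assumes "infinite (UNIV :: 'a::linorder set)"
  shows "\<exists>e :: int \<Rightarrow> 'a. strict_mono_on {a..b} e"
proof -
  obtain F :: "'a set" where F: "finite F" "card F = nat (b - a + 1)"
    using infinite_arbitrarily_large[OF assms] by blast
  define l where "l = sorted_list_of_set F"
  have "sorted_wrt (<) l" "length l = nat (b - a + 1)"
    using F by (simp_all add: l_def)
  then have "strict_mono_on {a..b} (\<lambda>i. l ! nat (i - a))"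
    by (intro strict_mono_onI sorted_wrt_nth_less[of "(<)" l]) auto
  then show ?thesis by blast
qed

lemma adversary_wins:
  fixes A :: "('s, 'a::linorder) online_alg" and e :: "int \<Rightarrow> 'a"
  assumes A: "valid_alg A" and m: "1 \<le> m" and e: "strict_mono_on {below m..above m} e"
  shows "\<exists>I. I \<noteq> [] \<and> distinct I \<and> OPT (Suc m) I \<le> 2 \<and> num_runs (online_output A (4 * m + 1) I) \<ge> 3"
proof -
  define B where "B = 4 * m + 1"
  define K where "K = {below m..above m}"
  have B: "1 \<le> B" "2 \<le> B" "length (base m) = B" using m by (auto simp: B_def length_base)
  have less: "e a < e b \<longleftrightarrow> a < b" and le: "e a \<le> e b \<longleftrightarrow> a \<le> b" if "a \<in> K" "b \<in> K" for a b
    using e that by (simp_all add: K_def strict_mono_on_less strict_mono_on_less_eq)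
  have inj: "inj_on e K"
    using e strict_mono_on_imp_inj_on by (auto simp: K_def)
  have dist: "distinct (map e J)" if "distinct J" "set J \<subseteq> K" for J
    using that inj by (auto simp: distinct_map intro: inj_on_subset)
  have baseK: "set (base m) \<subseteq> K" by (auto simp: set_base K_def below_def above_def)
  \<comment> \<open>\<open>base m\<close> just fills the buffer, so the first write is made before
    \<open>q\<close> is visible.\<close>
  note o1 = outp_props[OF A B(1) dist[OF distinct_base baseK], of 1]
  obtain x where x: "x \<in> set (base m)" "outp A B (map e (base m)) 1 = [e x]"
  proof -
    have "length (outp A B (map e (base m)) 1) = 1" "set (outp A B (map e (base m)) 1) \<subseteq> e ` set (base m)"
      using o1 B by auto
    then show ?thesis using that by (auto simp: length_Suc_conv)
  qed
  \<comment> \<open>\<open>2 * int m + 2\<close> is the median of \<open>base m\<close>, so a run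
    moving from \<open>x\<close> towards \<open>q\<close> finds at most 2m further elements of
    \<open>base m\<close>, and \<open>q\<close> itself.\<close>
  define q where "q = (if x \<le> 2 * int m + 2 then - 2 * int m - 1 else 4 * int m + 3)"
  have q: "distinct (base m @ [q])" "set (base m @ [q]) \<subseteq> K"
    using distinct_base baseK by (auto simp: q_def set_base K_def below_def above_def)
  obtain y where y: "y \<in> set (base m @ [q])" "outp A B (map e (base m @ [q])) 2 = [e x, e y]" "x \<noteq> y"
  proof -
    let ?I = "map e (base m @ [q])"
    have "length (outp A B ?I 2) = 2" "distinct (outp A B ?I 2)" "set (outp A B ?I 2) \<subseteq> e ` set (base m @ [q])"
      using outp_props[OF A B(1) dist[OF q], of 2] B by auto
    moreover have "outp A B ?I 1 = [e x]"
      using outp_append[OF A B(1) dist[OF distinct_base baseK], of 1 "[e q]"] x B by simp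
    with outp_take[of 1 2 A B ?I] obtain C where "outp A B ?I 2 = e x # C" by auto
    ultimately obtain z where z: "outp A B ?I 2 = [e x, z]" "z \<in> e ` set (base m @ [q])" "e x \<noteq> z"
      by (auto simp: length_Suc_conv numeral_2_eq_2)
    then obtain y where "y \<in> set (base m @ [q])" "z = e y" by blast
    then show ?thesis using that[of y] z by auto
  qed
  have xK: "x \<in> K" and yK: "y \<in> K" using x(1) y(1) baseK q(2) by auto
  \<comment> \<open>\<open>t\<close> is the continuation after \<open>q\<close>. Without sight of
    \<open>f\<close> the algorithm makes \<open>length t + 2\<close> writes, hence
    \<open>length t + 1\<close> from \<open>y\<close> on; \<open>card\<close> says that its run has
    no room for so many.\<close>
  have win: ?thesis
    if J: "distinct (base m @ q # t)" "set (base m @ q # t) \<subseteq> K - {below m, above m}"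
      and opt: "\<And>f. f \<in> {below m, above m} \<Longrightarrow> OPT (Suc m) (map e (base m @ (q # t) @ [f])) \<le> 2"
      and card: "x < y \<and> card {v \<in> set (base m @ q # t). y \<le> v} < Suc (length t)
        \<or> y < x \<and> card {v \<in> set (base m @ q # t). v \<le> y} < Suc (length t)" for t
  proof -
    let ?J = "base m @ q # t"
    let ?n = "Suc (Suc (length t))"
    define D where "D = outp A B (map e ?J) ?n"
    have JK: "set ?J \<subseteq> K" using J(2) by auto
    have D: "length D = ?n" "distinct D" "set D \<subseteq> e ` set ?J"
      using outp_props[OF A B(1) dist[OF J(1) JK], of ?n] B by (auto simp: D_def)
    have "outp A B (map e (base m @ [q]) @ map e t) 2 = [e x, e y]"
      using outp_append[OF A B(1) dist[OF q], of 2 "map e t"] y(2) B by simp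
    then have "outp A B (map e ?J) 2 = [e x, e y]" by simp
    with outp_take[of 2 ?n A B "map e ?J"] obtain D' where D': "D = e x # e y # D'"
      by (auto simp: D_def)
    have up: "{v \<in> e ` set ?J. e y \<le> v} = e ` {v \<in> set ?J. y \<le> v}"
      and dn: "{v \<in> e ` set ?J. v \<le> e y} = e ` {v \<in> set ?J. v \<le> y}"
      using le yK JK by blast+
    have nrun: "\<not> is_run D"
      using card
    proof (elim disjE conjE)
      assume "x < y" and c: "card {v \<in> set ?J. y \<le> v} < Suc (length t)"
      have "card {v \<in> e ` set ?J. e y \<le> v} < length D - 1"
        unfolding up using c D(1) card_image_le[of "{v \<in> set ?J. y \<le> v}" e] by simp
      then show ?thesis
        using not_is_run_up[OF D(2) D' _ D(3)] less xK yK \<open>x < y\<close> by simp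
    next
      assume "y < x" and c: "card {v \<in> set ?J. v \<le> y} < Suc (length t)"
      have "card {v \<in> e ` set ?J. v \<le> e y} < length D - 1"
        unfolding dn using c D(1) card_image_le[of "{v \<in> set ?J. v \<le> y}" e] by simp
      then show ?thesis
        using not_is_run_down[OF D(2) D' _ D(3)] less xK yK \<open>y < x\<close> by simp
    qed
    have ends: "below m \<in> K" "above m \<in> K" by (auto simp: K_def below_def above_def)
    have "e (below m) < e v" "e v < e (above m)" if "v \<in> set ?J" for v
    proof -
      have "v \<in> K" "v \<noteq> below m" "v \<noteq> above m" using that J(2) by auto
      moreover from this have "below m < v" "v < above m" by (auto simp: K_def)
      ultimately show "e (below m) < e v" "e v < e (above m)" using less ends by auto
    qed
    moreover have "e (below m) < e (above m)" using less ends by (simp add: below_def above_def)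
    ultimately have "\<exists>f\<in>{e (below m), e (above m)}. num_runs (online_output A B (map e ?J @ [f])) \<ge> 3"
      using nrun B by (intro not_run_forces_three[OF A B(2) dist[OF J(1) JK]]) (auto simp: D_def)
    then obtain f where f: "f \<in> {below m, above m}" "num_runs (online_output A B (map e (?J @ [f]))) \<ge> 3"
      by auto
    have "distinct (map e (?J @ [f]))"
      using J f(1) ends by (intro dist) auto
    then show ?thesis using f(2) opt[OF f(1)] by (intro exI[of _ "map e (?J @ [f])"]) (auto simp: B_def)
  qed
  have fin: "card S \<le> n" if "S \<subseteq> T" "finite T" "card T \<le> n" for S T :: "int set" and n
    using card_mono[OF that(2,1)] that(3) by simp
  have mid_ok: "distinct (base m @ q # mid m)" "set (base m @ q # mid m) \<subseteq> K - {below m, above m}"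
    using distinct_base distinct_mid m by (auto simp: q_def set_base set_mid K_def below_def above_def)
  have mid_opt: "OPT (Suc m) (map e (base m @ (q # mid m) @ [f])) \<le> 2" if "f \<in> {below m, above m}" for f
    using OPT_mid[OF e _ that, of q] by (auto simp: q_def split: if_splits)
  show ?thesis
  proof (cases "x \<le> 2 * int m + 2")
    case True
    then have q': "q = - 2 * int m - 1" by (simp add: q_def)
    show ?thesis
    proof (cases "x < y")
      case up: True
      \<comment> \<open>The descending continuation starts with the \<open>q\<close> already
        presented.\<close>
      obtain t where t: "q_low m = q # t"
      proof -
        have le: "- 6 * int m - 2 \<le> q" by (simp add: q')
        have "q_low m = rev [- 6 * int m - 2..q]" by (simp add: q_low_def q')
        then have "q_low m = q # rev [- 6 * int m - 2..q - 1]" unfolding upto_rec2[OF le] by simp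
        then show ?thesis by (rule that)
      qed
      have sq: "set (q # t) = {- 6 * int m - 2..- 2 * int m - 1}"
        unfolding t[symmetric] by (simp add: q_low_def)
      have len: "Suc (length t) = 4 * m + 2" using length_q_low[of m] t by simp
      show ?thesis
      proof (rule win[of t])
        show "distinct (base m @ q # t)" "set (base m @ q # t) \<subseteq> K - {below m, above m}"
          unfolding t[symmetric]
          using distinct_base m by (auto simp: q_low_def set_base K_def below_def above_def)
        show "OPT (Suc m) (map e (base m @ (q # t) @ [f])) \<le> 2" if "f \<in> {below m, above m}" for f
          using OPT_low[OF e that] t by simp
        \<comment> \<open>All of \<open>q_low m\<close> lies below \<open>x\<close>, so at most the
          4m + 1 elements of \<open>base m\<close> can serve for 4m + 2 writes.\<close>
        have "{v \<in> set (base m @ q # t). y \<le> v} \<subseteq> set (base m)"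
          using x(1) up unfolding set_append sq by (auto simp: set_base)
        then have "card {v \<in> set (base m @ q # t). y \<le> v} \<le> 4 * m + 1"
          by (rule fin) (use card_length[of "base m"] length_base[of m] in auto)
        then show "x < y \<and> card {v \<in> set (base m @ q # t). y \<le> v} < Suc (length t)
            \<or> y < x \<and> card {v \<in> set (base m @ q # t). v \<le> y} < Suc (length t)"
          using up len by simp
      qed
    next
      case False
      then have down: "y < x" using y(3) by simp
      \<comment> \<open>\<open>base m\<close> has no element between -1 and the median, so
        \<open>y\<close> lies below all of \<open>mid m\<close>: 2m + 1 candidates, \<open>q\<close>
        included, for 2m + 2 writes.\<close>
      then have "y \<le> -1" using y(1) True by (auto simp: set_base q')
      then have "{v \<in> set (base m @ q # mid m). v \<le> y} \<subseteq> {- 2 * int m - 1..-1}"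
        by (auto simp: set_base set_mid q')
      then have "card {v \<in> set (base m @ q # mid m). v \<le> y} \<le> 2 * m + 1"
        by (rule fin) auto
      then show ?thesis
        using down length_mid[of m] by (intro win[OF mid_ok mid_opt]) auto
    qed
  next
    case False
    then have q': "q = 4 * int m + 3" by (simp add: q_def)
    show ?thesis
    proof (cases "x < y")
      case up: True
      \<comment> \<open>Now \<open>y\<close> lies above all of \<open>mid m\<close>, again with 2m +
        1 candidates for 2m + 2 writes.\<close>
      then have "{v \<in> set (base m @ q # mid m). y \<le> v} \<subseteq> {2 * int m + 3..4 * int m + 3}"
        using False by (auto simp: set_base set_mid q')
      then have "card {v \<in> set (base m @ q # mid m). y \<le> v} \<le> 2 * m + 1"
        by (rule fin) auto
      then show ?thesis
        using up length_mid[of m] by (intro win[OF mid_ok mid_opt]) auto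
    next
      case notup: False
      then have down: "y < x" using y(3) by simp
      obtain t where t: "q_high m = q # t"
        using upto_rec1[of "4 * int m + 3" "8 * int m + 4"] q' by (auto simp: q_high_def)
      have sq: "set (q # t) = {4 * int m + 3..8 * int m + 4}"
        unfolding t[symmetric] by (simp add: q_high_def)
      have len: "Suc (length t) = 4 * m + 2" using length_q_high[of m] t by simp
      show ?thesis
      proof (rule win[of t])
        show "distinct (base m @ q # t)" "set (base m @ q # t) \<subseteq> K - {below m, above m}"
          unfolding t[symmetric]
          using distinct_base m by (auto simp: q_high_def set_base K_def below_def above_def)
        show "OPT (Suc m) (map e (base m @ (q # t) @ [f])) \<le> 2" if "f \<in> {below m, above m}" for f
          using OPT_high[OF e that] t by simp
        \<comment> \<open>All of \<open>q_high m\<close> lies above \<open>x\<close>, so again only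
          \<open>base m\<close> can serve.\<close>
        have "{v \<in> set (base m @ q # t). v \<le> y} \<subseteq> set (base m)"
          using x(1) down unfolding set_append sq by (auto simp: set_base)
        then have "card {v \<in> set (base m @ q # t). v \<le> y} \<le> 4 * m + 1"
          by (rule fin) (use card_length[of "base m"] length_base[of m] in auto)
        then show "x < y \<and> card {v \<in> set (base m @ q # t). y \<le> v} < Suc (length t)
            \<or> y < x \<and> card {v \<in> set (base m @ q # t). v \<le> y} < Suc (length t)"
          using down len by simp
      qed
    qed
  qed
qed

theorem theorem10:
  fixes A :: "('s, 'a::linorder) online_alg" and M B :: nat
  assumes "infinite (UNIV :: 'a set)"
    and "M \<ge> 2"
    and "valid_alg A"
    and "1 \<le> B" and "B < 4 * M - 2"
  shows "\<exists>I :: 'a list. I \<noteq> [] \<and> distinct I \<and>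
    real (num_runs (online_output A B I)) \<ge> 3 / 2 * real (OPT M I)"
proof -
  obtain m where m: "M = Suc m" using assms(2) by (cases M) auto
  obtain e :: "int \<Rightarrow> 'a" where "strict_mono_on {below m..above m} e"
    using ex_strict_mono_on_int_interval[OF assms(1)] by blast
  from adversary_wins[OF valid_alg_with_view[OF assms(3,4)] _ this] m assms(2)
  obtain I where I: "I \<noteq> []" "distinct I" "OPT M I \<le> 2"
    "num_runs (online_output (with_view B A) (4 * m + 1) I) \<ge> 3"
    by auto
  \<comment> \<open>\<open>4 * m + 1\<close> equals \<open>4 * M - 3\<close>, the largest size that
    \<open>B\<close> may have.\<close>
  then have "num_runs (online_output A B I) \<ge> 3"
    using online_output_with_view[OF assms(3,4) _ I(2), of "4 * m + 1"] assms(5) m by simp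
  then show ?thesis using I by (intro exI[of _ I]) auto
qed

end
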